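(* $$\Pr(132\prec231)=\frac{e^2-2e-1}{2}\approx 0.476.$$
   Context: For a sequence of distinct reals, $\mathrm{st}$ replaces the smallest entry by $1$, the second smallest by $2$, etc. Let $X_1,X_2,\dots$ be i.i.d. continuous random variables (e.g. uniform on $[0,1]$). A consecutive occurrence of a permutation $\sigma$ of $\{1,\dots,k\}$ is a block $X_i,\dots,X_{i+k-1}$ with $\mathrm{st}(X_i\dots X_{i+k-1})=\sigma$. For distinct permutations $\sigma,\tau$ of the same length, $\Pr(\sigma\prec\tau)$ is the probability that the first consecutive occurrence of $\sigma$ appears before the first consecutive occurrence of $\tau$. *)

theory Defs
  imports "HOL-Probability.Probability"
begin

text \<open>Permutations of \<open>{1..k}\<close> are written in one-line notation, as lists. If the entries of \<open>xs\<close>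
  are not distinct, then neither are those of \<open>st xs\<close>, so \<open>st xs\<close> is not a permutation and a block
  with ties is an occurrence of no permutation.\<close>

definition st :: "real list \<Rightarrow> nat list" where
  "st xs = map (\<lambda>x. card {y \<in> set xs. y \<le> x}) xs"

definition occurs_at :: "nat list \<Rightarrow> (nat \<Rightarrow> real) \<Rightarrow> nat \<Rightarrow> bool" where
  "occurs_at \<sigma> x i \<longleftrightarrow> st (map x [i..<i + length \<sigma>]) = \<sigma>"

text \<open>The value is \<open>\<infinity>\<close> if there is no occurrence.\<close>

definition first_occurrence :: "nat list \<Rightarrow> (nat \<Rightarrow> real) \<Rightarrow> enat" where
  "first_occurrence \<sigma> x = Inf (enat ` {i. occurs_at \<sigma> x i})"

definition prob_before ::
  "'a measure \<Rightarrow> (nat \<Rightarrow> 'a \<Rightarrow> real) \<Rightarrow> nat list \<Rightarrow> nat list \<Rightarrow> real" where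
  "prob_before M X \<sigma> \<tau> = measure M {\<omega> \<in> space M.
     first_occurrence \<sigma> (\<lambda>n. X n \<omega>) < first_occurrence \<tau> (\<lambda>n. X n \<omega>)}"

text \<open>Continuity is absence of atoms, i.e. continuity of the distribution function; a density is
  not required.\<close>

definition iid_continuous :: "'a measure \<Rightarrow> (nat \<Rightarrow> 'a \<Rightarrow> real) \<Rightarrow> bool" where
  "iid_continuous M X \<longleftrightarrow>
     prob_space.indep_vars M (\<lambda>_. borel) X UNIV \<and>
     (\<forall>i. distr M borel (X i) = distr M borel (X 0)) \<and>
     (\<forall>a. measure (distr M borel (X 0)) {a} = 0)"

end

theory Submission
  imports Defs
begin

text \<open>
  In both 132 and 231 the middle entry is the largest. So an occurrence of either pattern is a peak
  of the sequence, and a peak whose two outer entries differ is an occurrence of exactly one of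
  them. Ties have probability zero, hence 132 comes first exactly when the first peak of the sequence
  is a 132 (lemma \<open>first_132_before_231_iff\<close>).

  Let the first peak be at position \<open>n\<close>. Before it there is no peak, which means that the entries
  \<open>0, \<dots>, n + 1\<close> first fall and then rise. The 132 condition says that entry \<open>n + 2\<close> lies
  between entries \<open>n\<close> and \<open>n + 1\<close>. Exchanging the last two entries turns this into something
  simpler: the whole block of length \<open>N = n + 3\<close> falls and then rises, with at least two ascents
  at the end (lemma \<open>first_peak_132_iff_valley\<close>). An i.i.d. sequence does not notice the
  exchange.

  Among the \<open>N!\<close> equally likely orders of a block, \<open>N - 1 choose j\<close> have their only valley at
  position \<open>j\<close> (lemma \<open>prob_valley\<close>). At least two ascents means \<open>j \<le> N - 3\<close>, and
  the sum of these coefficients is \<open>2 ^ (N - 1) - N\<close>. Summing \<open>(2 ^ (N - 1) - N) / N!\<close> over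
  \<open>N \<ge> 3\<close> with the exponential series gives \<open>(exp 2 - 5) / 2 - (exp 1 - 2)\<close>, which is the
  claimed value.
\<close>

section \<open>Consecutive occurrences as order conditions\<close>

definition rank :: "real set \<Rightarrow> real \<Rightarrow> nat" where
  "rank S x = card {y \<in> S. y \<le> x}"

text \<open>Standardization keeps the order of the entries, so a pattern can be read as a chain of
  inequalities.\<close>

lemma rank_less_iff:
  assumes "finite S" "x \<in> S" "y \<in> S"
  shows "rank S x < rank S y \<longleftrightarrow> x < y"
proof -
  have less: "rank S u < rank S v" if "u < v" "v \<in> S" for u v
    unfolding rank_def
  proof (rule psubset_card_mono)
    show "{z \<in> S. z \<le> u} \<subset> {z \<in> S. z \<le> v}" using that by force
  qed (use assms in simp)
  show ?thesis
    using less[of x y] less[of y x] assms by (metis less_asym linorder_less_linear)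
qed

lemma st_three: "st [a, b, c] = map (rank {a, b, c}) [a, b, c]"
  by (simp add: st_def rank_def)

lemma st_eq_132_iff: "st [a, b, c] = [1, 3, 2] \<longleftrightarrow> a < c \<and> c < b"
proof
  assume "st [a, b, c] = [1, 3, 2]"
  then have "rank {a, b, c} a < rank {a, b, c} c" "rank {a, b, c} c < rank {a, b, c} b"
    by (simp_all add: st_three)
  then show "a < c \<and> c < b" by (simp add: rank_less_iff)
next
  assume "a < c \<and> c < b"
  then have "{y \<in> {a, b, c}. y \<le> a} = {a}" "{y \<in> {a, b, c}. y \<le> b} = {a, b, c}"
    "{y \<in> {a, b, c}. y \<le> c} = {a, c}" "a \<noteq> b" "a \<noteq> c" "b \<noteq> c"
    by auto
  then show "st [a, b, c] = [1, 3, 2]"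
    unfolding st_three rank_def by (simp del: Collect_disj_eq)
qed

lemma st_eq_231_iff: "st [a, b, c] = [2, 3, 1] \<longleftrightarrow> c < a \<and> a < b"
proof
  assume "st [a, b, c] = [2, 3, 1]"
  then have "rank {a, b, c} c < rank {a, b, c} a" "rank {a, b, c} a < rank {a, b, c} b"
    by (simp_all add: st_three)
  then show "c < a \<and> a < b" by (simp add: rank_less_iff)
next
  assume "c < a \<and> a < b"
  then have "{y \<in> {a, b, c}. y \<le> a} = {a, c}" "{y \<in> {a, b, c}. y \<le> b} = {a, b, c}"
    "{y \<in> {a, b, c}. y \<le> c} = {c}" "a \<noteq> b" "a \<noteq> c" "b \<noteq> c"
    by auto
  then show "st [a, b, c] = [2, 3, 1]"
    unfolding st_three rank_def by (simp del: Collect_disj_eq)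
qed

lemma block_of_three: "map x [i..<i + 3] = [x i, x (Suc i), x (Suc (Suc i))]"
  by (simp add: upt_rec numeral_3_eq_3)

lemma occurs_at_132_iff:
  "occurs_at [1, 3, 2] x i \<longleftrightarrow> x i < x (Suc (Suc i)) \<and> x (Suc (Suc i)) < x (Suc i)"
  using st_eq_132_iff[of "x i" "x (Suc i)" "x (Suc (Suc i))"]
  by (simp add: occurs_at_def block_of_three)

lemma occurs_at_231_iff:
  "occurs_at [2, 3, 1] x i \<longleftrightarrow> x (Suc (Suc i)) < x i \<and> x i < x (Suc i)"
  using st_eq_231_iff[of "x i" "x (Suc i)" "x (Suc (Suc i))"]
  by (simp add: occurs_at_def block_of_three)

text \<open>This form is a countable combination of conditions on finitely many entries, which makes the
  event measurable, and it also covers sequences in which a pattern never occurs.\<close>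

lemma first_occurrence_less_iff:
  "first_occurrence \<sigma> x < first_occurrence \<tau> x \<longleftrightarrow>
     (\<exists>n. occurs_at \<sigma> x n \<and> (\<forall>i<n. \<not> occurs_at \<sigma> x i) \<and> (\<forall>i\<le>n. \<not> occurs_at \<tau> x i))"
    (is "?L \<longleftrightarrow> ?R")
proof -
  have later: "enat n < first_occurrence \<tau> x \<longleftrightarrow> (\<forall>i\<le>n. \<not> occurs_at \<tau> x i)" for n
  proof
    assume "enat n < first_occurrence \<tau> x"
    then show "\<forall>i\<le>n. \<not> occurs_at \<tau> x i"
      unfolding first_occurrence_def
      by (metis (mono_tags, lifting) Inf_lower enat_ord_simps(1) image_eqI leD le_less_trans
          mem_Collect_eq)
  next
    assume none: "\<forall>i\<le>n. \<not> occurs_at \<tau> x i"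
    have "enat (Suc n) \<le> first_occurrence \<tau> x"
      unfolding first_occurrence_def
    proof (rule Inf_greatest)
      fix e assume "e \<in> enat ` {i. occurs_at \<tau> x i}"
      then obtain i where "e = enat i" "occurs_at \<tau> x i" by auto
      with none show "enat (Suc n) \<le> e" by (simp add: Suc_le_eq) (metis not_le)
    qed
    then show "enat n < first_occurrence \<tau> x"
      by (metis enat_ord_simps(2) lessI less_le_trans)
  qed
  have "?L \<longleftrightarrow> (\<exists>m. occurs_at \<sigma> x m \<and> (\<forall>i\<le>m. \<not> occurs_at \<tau> x i))"
    unfolding first_occurrence_def[of \<sigma>] Inf_less_iff by (auto simp: later)
  also have "\<dots> \<longleftrightarrow> ?R"
  proof
    assume "\<exists>m. occurs_at \<sigma> x m \<and> (\<forall>i\<le>m. \<not> occurs_at \<tau> x i)"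
    then obtain m where m: "occurs_at \<sigma> x m" "\<forall>i\<le>m. \<not> occurs_at \<tau> x i" by blast
    define n where "n = (LEAST i. occurs_at \<sigma> x i)"
    have "occurs_at \<sigma> x n" "n \<le> m" "\<forall>i<n. \<not> occurs_at \<sigma> x i"
      using m(1) unfolding n_def by (auto intro: LeastI Least_le dest: not_less_Least)
    with m(2) show ?R by (metis le_trans)
  qed blast
  finally show ?thesis .
qed

section \<open>Valleys\<close>

text \<open>All shapes below are stated through neighbouring entries. In \<open>two_runs j N\<close> nothing is said
  about the step from \<open>j - 1\<close> to \<open>j\<close>, so it concerns two disjoint blocks of entries.\<close>

definition rising :: "nat \<Rightarrow> (nat \<Rightarrow> real) \<Rightarrow> bool" where
  "rising k y \<longleftrightarrow> (\<forall>i. Suc i < k \<longrightarrow> y i < y (Suc i))"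

lemma falling_iff_rising_reversed:
  "(\<forall>i. Suc i < j \<longrightarrow> y (Suc i) < y i) \<longleftrightarrow>
     rising j (\<lambda>n. y (if n < j then j - Suc n else n))" (is "?L \<longleftrightarrow> ?R")
proof
  assume L: ?L
  show ?R unfolding rising_def
  proof (intro allI impI)
    fix i assume "Suc i < j"
    with L[rule_format, of "j - Suc (Suc i)"]
    show "y (if i < j then j - Suc i else i) < y (if Suc i < j then j - Suc (Suc i) else Suc i)"
      by (simp add: Suc_diff_Suc)
  qed
next
  assume R: ?R
  show ?L
  proof (intro allI impI)
    fix i assume "Suc i < j"
    with R[unfolded rising_def, rule_format, of "j - Suc (Suc i)"]
    show "y (Suc i) < y i" by (simp add: Suc_diff_Suc)
  qed
qed

lemma rising_from_iff:
  "(\<forall>i. j \<le> i \<and> Suc i < N \<longrightarrow> y i < y (Suc i)) \<longleftrightarrow> rising (N - j) (\<lambda>n. y (n + j))"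
    (is "?L \<longleftrightarrow> ?R")
proof
  assume R: ?R
  show ?L
  proof (intro allI impI)
    fix i assume "j \<le> i \<and> Suc i < N"
    with R[unfolded rising_def, rule_format, of "i - j"] show "y i < y (Suc i)" by auto
  qed
qed (auto simp: rising_def)

definition two_runs :: "nat \<Rightarrow> nat \<Rightarrow> (nat \<Rightarrow> real) \<Rightarrow> bool" where
  "two_runs j N x \<longleftrightarrow>
     (\<forall>i. Suc i < j \<longrightarrow> x (Suc i) < x i) \<and> (\<forall>i. j \<le> i \<and> Suc i < N \<longrightarrow> x i < x (Suc i))"

definition valley :: "nat \<Rightarrow> nat \<Rightarrow> (nat \<Rightarrow> real) \<Rightarrow> bool" where
  "valley j N x \<longleftrightarrow>
     (\<forall>i<j. x (Suc i) < x i) \<and> (\<forall>i. j \<le> i \<and> Suc i < N \<longrightarrow> x i < x (Suc i))"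

lemma valley_unique:
  assumes "valley j N x" "valley k N x" "j < N" "k < N"
  shows "j = k"
proof -
  have "\<not> a < b" if "valley a N x" "valley b N x" "b < N" for a b
  proof
    assume "a < b"
    with that have "x a < x (Suc a)" "x (Suc a) < x a" by (auto simp: valley_def)
    then show False by simp
  qed
  with assms show ?thesis by (meson linorder_neqE_nat)
qed

text \<open>The step between the two runs either falls or rises; it decides to which run the minimum
  belongs.\<close>

lemma two_runs_Suc_iff:
  assumes "Suc j < N" "x j \<noteq> x (Suc j)"
  shows "two_runs (Suc j) N x \<longleftrightarrow> valley (Suc j) N x \<or> valley j N x"
proof
  assume runs: "two_runs (Suc j) N x"
  show "valley (Suc j) N x \<or> valley j N x"
  proof (cases "x j < x (Suc j)")
    case True
    then have "valley j N x"
      using runs unfolding two_runs_def valley_def by (metis Suc_le_eq Suc_less_eq le_less)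
    then show ?thesis ..
  next
    case False
    with assms(2) have "x (Suc j) < x j" by simp
    then have "valley (Suc j) N x"
      using runs unfolding two_runs_def valley_def by (metis Suc_less_eq less_Suc_eq)
    then show ?thesis ..
  qed
qed (auto simp: two_runs_def valley_def)

definition first_peak_132 :: "nat \<Rightarrow> (nat \<Rightarrow> real) \<Rightarrow> bool" where
  "first_peak_132 n x \<longleftrightarrow>
     (\<forall>i<n. \<not> (x i < x (Suc i) \<and> x (Suc (Suc i)) < x (Suc i))) \<and>
     x n < x (Suc (Suc n)) \<and> x (Suc (Suc n)) < x (Suc n)"

text \<open>The outer entries of a peak are distinct, so every peak is an occurrence of one of the two
  patterns, and the race is decided at the first peak.\<close>

lemma first_132_before_231_iff:
  assumes "inj x"
  shows "first_occurrence [1, 3, 2] x < first_occurrence [2, 3, 1] x \<longleftrightarrow>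
           (\<exists>n. first_peak_132 n x)"
proof -
  have peak: "x i < x (Suc i) \<and> x (Suc (Suc i)) < x (Suc i) \<longleftrightarrow>
      occurs_at [1, 3, 2] x i \<or> occurs_at [2, 3, 1] x i" for i
  proof -
    have "x i \<noteq> x (Suc (Suc i))" using injD[OF assms, of i "Suc (Suc i)"] by auto
    then show ?thesis unfolding occurs_at_132_iff occurs_at_231_iff by linarith
  qed
  have not_both: "\<not> occurs_at [2, 3, 1] x n" if "occurs_at [1, 3, 2] x n" for n
    using that by (auto simp: occurs_at_132_iff[simplified] occurs_at_231_iff[simplified])
  show ?thesis
    unfolding first_occurrence_less_iff first_peak_132_def peak
    unfolding occurs_at_132_iff[symmetric]
    using not_both by (metis le_less)
qed

lemma first_peak_132_unique:
  assumes "first_peak_132 m x" "first_peak_132 n x"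
  shows "m = n"
  using assms unfolding first_peak_132_def by (metis less_trans linorder_neqE_nat)

text \<open>A sequence without peaks cannot fall again once it has risen, so it is a valley. For a 132 at
  \<open>n\<close> the last three entries in the order \<open>n, n + 2, n + 1\<close> are increasing; exchanging the
  last two therefore continues the valley by two ascents. These two ascents are what the bound
  \<open>j \<le> n\<close> on the position of the minimum expresses.\<close>

lemma first_peak_132_iff_valley:
  fixes n :: nat
  defines "swap \<equiv> Transposition.transpose (Suc n) (Suc (Suc n))"
  assumes "inj x"
  shows "first_peak_132 n x \<longleftrightarrow> (\<exists>j\<le>n. valley j (n + 3) (\<lambda>i. x (swap i)))"
proof
  have swap: "swap (Suc n) = Suc (Suc n)" "swap (Suc (Suc n)) = Suc n"
    "\<And>i. i \<le> n \<Longrightarrow> swap i = i"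
    by (auto simp: swap_def transpose_def)
  {
    assume peak: "first_peak_132 n x"
    \<comment> \<open>The minimum is where the sequence rises for the first time.\<close>
    define j where "j = (LEAST i. x i < x (Suc i))"
    have xn: "x n < x (Suc n)" using peak by (auto simp: first_peak_132_def)
    then have j: "x j < x (Suc j)" "j \<le> n" unfolding j_def
      by (rule LeastI[of "\<lambda>i. x i < x (Suc i)"], rule Least_le)
    have down: "x (Suc i) < x i" if "i < j" for i
    proof -
      have "\<not> x i < x (Suc i)" using that not_less_Least unfolding j_def by blast
      moreover have "x i \<noteq> x (Suc i)" using injD[OF assms(2), of i "Suc i"] by auto
      ultimately show ?thesis by simp
    qed
    have up: "x i < x (Suc i)" if "j \<le> i" "i \<le> n" for i
      using that
    proof (induction i rule: dec_induct)
      case (step i)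
      then have "\<not> x (Suc (Suc i)) < x (Suc i)"
        using peak by (auto simp: first_peak_132_def)
      moreover have "x (Suc i) \<noteq> x (Suc (Suc i))"
        using injD[OF assms(2), of "Suc i" "Suc (Suc i)"] by auto
      ultimately show ?case by simp
    qed (use j in simp)
    have "valley j (n + 3) (\<lambda>i. x (swap i))"
      unfolding valley_def
    proof (intro conjI allI impI)
      fix i assume "i < j"
      with down j show "x (swap (Suc i)) < x (swap i)" by (simp add: swap)
    next
      fix i assume i: "j \<le> i \<and> Suc i < n + 3"
      then consider "i < n" | "i = n" | "i = Suc n" by linarith
      then show "x (swap i) < x (swap (Suc i))"
        using i up peak by cases (auto simp: swap first_peak_132_def)
    qed
    with j show "\<exists>j\<le>n. valley j (n + 3) (\<lambda>i. x (swap i))" by blast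
  }
  {
    assume "\<exists>j\<le>n. valley j (n + 3) (\<lambda>i. x (swap i))"
    then obtain j where j: "j \<le> n"
      and down: "\<And>i. i < j \<Longrightarrow> x (swap (Suc i)) < x (swap i)"
      and up: "\<And>i. j \<le> i \<Longrightarrow> Suc i < n + 3 \<Longrightarrow> x (swap i) < x (swap (Suc i))"
      by (auto simp: valley_def)
    have n: "x n < x (Suc (Suc n))" "x (Suc (Suc n)) < x (Suc n)"
      using up[of n] up[of "Suc n"] j by (simp_all add: swap)
    have "\<not> (x i < x (Suc i) \<and> x (Suc (Suc i)) < x (Suc i))" if "i < n" for i
    proof (cases "i < j")
      case True
      with down[of i] that show ?thesis by (simp add: swap)
    next
      case False
      show ?thesis
      proof (cases "Suc i = n")
        case True
        with n show ?thesis by auto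
      next
        case neq: False
        with up[of "Suc i"] that False show ?thesis by (simp add: swap)
      qed
    qed
    with n show "first_peak_132 n x" by (auto simp: first_peak_132_def)
  }
qed

section \<open>Sorting permutations\<close>

text \<open>Exactly one permutation sorts \<open>k\<close> distinct values. Hence the events that a given permutation
  sorts the first \<open>k\<close> variables partition the sample space up to a null set.\<close>

lemma ex_sorting_permutation:
  fixes x :: "nat \<Rightarrow> real"
  assumes "inj x"
  shows "\<exists>p. p permutes {..<k} \<and> rising k (\<lambda>i. x (p i))"
proof -
  define ys where "ys = sorted_list_of_set (x ` {..<k})"
  have inj: "inj_on x {..<k}" using assms by (rule inj_on_subset) simp
  have len: "length ys = k" using inj by (simp add: ys_def card_image)
  have set: "set ys = x ` {..<k}" by (simp add: ys_def)
  define p where "p i = (if i < k then inv_into {..<k} x (ys ! i) else i)" for i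
  have xp: "x (p i) = ys ! i" and pk: "p i < k" if "i < k" for i
  proof -
    have "ys ! i \<in> x ` {..<k}" using that len set nth_mem by blast
    then show "x (p i) = ys ! i" "p i < k"
      using that inv_into_into[of "ys ! i" x "{..<k}"] by (simp_all add: p_def f_inv_into_f)
  qed
  have "inj_on p {..<k}"
  proof (rule inj_onI)
    fix i i' assume "i \<in> {..<k}" "i' \<in> {..<k}" "p i = p i'"
    then have "ys ! i = ys ! i'" "i < k" "i' < k" using xp by (metis lessThan_iff)+
    moreover have "distinct ys" by (simp add: ys_def)
    ultimately show "i = i'" using len by (simp add: nth_eq_iff_index_eq)
  qed
  moreover have "p ` {..<k} \<subseteq> {..<k}" using pk by auto
  ultimately have "bij_betw p {..<k} {..<k}"
    by (simp add: bij_betw_def endo_inj_surj)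
  then have "p permutes {..<k}"
    by (rule bij_imp_permutes) (simp add: p_def)
  moreover have "rising k (\<lambda>i. x (p i))"
    unfolding rising_def
  proof (intro allI impI)
    fix i assume "Suc i < k"
    moreover have "sorted_wrt (<) ys" by (simp add: ys_def)
    ultimately show "x (p i) < x (p (Suc i))"
      using xp[of i] xp[of "Suc i"] len by (simp add: sorted_wrt_nth_less)
  qed
  ultimately show ?thesis by blast
qed

lemma sorting_permutation_unique:
  fixes x :: "nat \<Rightarrow> real"
  assumes "inj x" "p permutes {..<k}" "q permutes {..<k}"
    and "rising k (\<lambda>i. x (p i))" "rising k (\<lambda>i. x (q i))"
  shows "p = q"
proof -
  have strict: "sorted_wrt (<) (map (\<lambda>i. x (r i)) [0..<k])" if "rising k (\<lambda>i. x (r i))" for r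
    using that by (auto simp: sorted_wrt_iff_nth_Suc_transp rising_def)
  have set: "set (map (\<lambda>i. x (r i)) [0..<k]) = x ` {..<k}" if "r permutes {..<k}" for r
    using permutes_image[OF that] by (simp add: atLeast0LessThan image_comp[symmetric] comp_def flip: image_image)
  have "map (\<lambda>i. x (p i)) [0..<k] = map (\<lambda>i. x (q i)) [0..<k]"
    using strict[of p] strict[of q] set[of p] set[of q] assms
    by (intro sorted_distinct_set_unique) (simp_all add: strict_sorted_iff)
  then have "x (p i) = x (q i)" if "i < k" for i using that by simp
  then have "p i = q i" if "i < k" for i using that injD[OF assms(1)] by blast
  with assms(2,3) show ?thesis
    by (metis ext lessThan_iff permutes_not_in)
qed

section \<open>Order events of an i.i.d. continuous sequence\<close>

locale iid_continuous_sequence = prob_space M for M :: "'a measure" +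
  fixes X :: "nat \<Rightarrow> 'a \<Rightarrow> real"
  assumes iid: "iid_continuous M X"
begin

lemma indep: "indep_vars (\<lambda>_. borel) X UNIV"
  and same_distr: "distr M borel (X i) = distr M borel (X 0)"
  and no_atom: "measure (distr M borel (X 0)) {a} = 0"
  using iid unfolding iid_continuous_def by blast+

lemma X_measurable [measurable]: "X i \<in> borel_measurable M"
  using indep unfolding indep_vars_def by blast

text \<open>The joint law of two of the variables is a product, and the diagonal meets every vertical line
  in a single point, which has measure zero because the common law has no atoms.\<close>

lemma AE_neq:
  assumes "i \<noteq> j"
  shows "AE \<omega> in M. X i \<omega> \<noteq> X j \<omega>"
proof -
  let ?D = "distr M borel (X 0)"
  interpret D: prob_space ?D by (rule prob_space_distr) simp
  interpret DD: pair_prob_space ?D ?D ..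
  have "indep_var (PiM {i} (\<lambda>_. borel)) (\<lambda>\<omega>. restrict (\<lambda>i. X i \<omega>) {i})
      (PiM {j} (\<lambda>_. borel)) (\<lambda>\<omega>. restrict (\<lambda>i. X i \<omega>) {j})"
    using indep by (rule indep_var_restrict) (use assms in auto)
  from indep_var_compose[OF this, of "\<lambda>x. x i" borel "\<lambda>x. x j" borel]
  have "indep_var borel (X i) borel (X j)"
    by (simp add: comp_def)
  then have joint: "?D \<Otimes>\<^sub>M ?D = distr M (borel \<Otimes>\<^sub>M borel) (\<lambda>\<omega>. (X i \<omega>, X j \<omega>))"
    using same_distr[of i] same_distr[of j] by (simp add: indep_var_distribution_eq)
  define diag where "diag = {z \<in> space (borel \<Otimes>\<^sub>M borel :: (real \<times> real) measure). fst z = snd z}"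
  have diag: "diag \<in> sets (borel \<Otimes>\<^sub>M borel)"
    unfolding diag_def by measurable
  have "emeasure (?D \<Otimes>\<^sub>M ?D) diag = (\<integral>\<^sup>+ u. emeasure ?D (Pair u -` diag) \<partial>?D)"
    by (rule D.emeasure_pair_measure_alt) (use diag in \<open>simp cong: sets_pair_measure_cong\<close>)
  also have "\<dots> = (\<integral>\<^sup>+ u. 0 \<partial>?D)"
  proof (rule nn_integral_cong)
    fix u
    have "Pair u -` diag = {u}" by (auto simp: diag_def space_pair_measure)
    then show "emeasure ?D (Pair u -` diag) = 0"
      by (simp add: D.emeasure_eq_measure no_atom)
  qed
  finally have "emeasure (distr M (borel \<Otimes>\<^sub>M borel) (\<lambda>\<omega>. (X i \<omega>, X j \<omega>))) diag = 0"
    by (simp add: joint)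
  then have "emeasure M ((\<lambda>\<omega>. (X i \<omega>, X j \<omega>)) -` diag \<inter> space M) = 0"
    using diag by (subst (asm) emeasure_distr) auto
  moreover have "(\<lambda>\<omega>. (X i \<omega>, X j \<omega>)) -` diag \<inter> space M = {\<omega> \<in> space M. X i \<omega> = X j \<omega>}"
    by (auto simp: diag_def space_pair_measure)
  ultimately show ?thesis by (subst AE_iff_measurable[OF _ refl]) auto
qed

lemma AE_inj: "AE \<omega> in M. inj (\<lambda>n. X n \<omega>)"
proof -
  have "AE \<omega> in M. i \<noteq> j \<longrightarrow> X i \<omega> \<noteq> X j \<omega>" for i j
    by (cases "i = j") (simp_all add: AE_neq)
  then have "AE \<omega> in M. \<forall>i j. i \<noteq> j \<longrightarrow> X i \<omega> \<noteq> X j \<omega>"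
    unfolding AE_all_countable by blast
  then show ?thesis by eventually_elim (auto simp: inj_def)
qed

text \<open>Exchangeability: along distinct indices the variables are again independent with the same law,
  so the law of the whole sequence is the same infinite product measure.\<close>

lemma prob_reindex:
  assumes f: "inj f" and [measurable]: "Measurable.pred (PiM UNIV (\<lambda>_. borel)) P"
  shows "prob {\<omega> \<in> space M. P (\<lambda>n. X (f n) \<omega>)} = prob {\<omega> \<in> space M. P (\<lambda>n. X n \<omega>)}"
proof -
  let ?S = "PiM UNIV (\<lambda>_::nat. borel :: real measure)"
  let ?D = "PiM UNIV (\<lambda>_::nat. distr M borel (X 0))"
  let ?A = "{x \<in> space ?S. P x}"
  have sets_D: "sets ?D = sets ?S" by (intro sets_PiM_cong) auto
  have X: "(\<lambda>\<omega> n. X (g n) \<omega>) \<in> measurable M ?S" for g :: "nat \<Rightarrow> nat"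
  proof -
    have "(\<lambda>\<omega>. \<lambda>n\<in>UNIV. X (g n) \<omega>) \<in> measurable M ?S"
      by (rule measurable_restrict) (rule X_measurable)
    then show ?thesis by (simp only: restrict_UNIV)
  qed
  have shift: "(\<lambda>x n. x (f n)) \<in> measurable ?S ?S"
  proof -
    have "(\<lambda>x. \<lambda>n\<in>UNIV. x (f n)) \<in> measurable ?S ?S"
      by (rule measurable_restrict) (rule measurable_component_singleton[OF UNIV_I])
    then show ?thesis by (simp only: restrict_UNIV)
  qed
  have law: "distr M ?S (\<lambda>\<omega> n. X n \<omega>) = ?D"
  proof -
    have "distr M ?S (\<lambda>\<omega> n. X n \<omega>) = PiM UNIV (\<lambda>i. distr M borel (X i))"
      using indep_vars_iff_distr_eq_PiM[of UNIV X "\<lambda>_. borel"] indep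
      by (simp add: restrict_UNIV)
    also have "\<dots> = ?D" by (intro PiM_cong refl same_distr)
    finally show ?thesis .
  qed
  have "?D = distr ?D ?D (\<lambda>x n. x (f n))"
    using distr_PiM_reindex[of UNIV "\<lambda>_. distr M borel (X 0)" f UNIV] f
    by (simp add: prob_space_distr restrict_UNIV)
  also have "\<dots> = distr ?D ?S (\<lambda>x n. x (f n))"
    by (rule distr_cong) (simp_all add: sets_D)
  also have "\<dots> = distr (distr M ?S (\<lambda>\<omega> n. X n \<omega>)) ?S (\<lambda>x n. x (f n))"
    by (simp add: law)
  also have "\<dots> = distr M ?S (\<lambda>\<omega> n. X (f n) \<omega>)"
    by (subst distr_distr[OF shift X]) (simp add: comp_def)
  finally have same_law: "distr M ?S (\<lambda>\<omega> n. X (f n) \<omega>) = distr M ?S (\<lambda>\<omega> n. X n \<omega>)"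
    by (simp add: law)
  have push: "measure (distr M ?S (\<lambda>\<omega> n. X (g n) \<omega>)) ?A = prob {\<omega> \<in> space M. P (\<lambda>n. X (g n) \<omega>)}"
    for g :: "nat \<Rightarrow> nat"
    by (subst measure_distr[OF X])
       (use X[THEN measurable_space] in \<open>auto intro!: arg_cong[where f = prob]\<close>)
  show ?thesis using push[of f] push[of id] same_law by simp
qed

lemma rising_measurable [measurable]:
  "Measurable.pred (PiM UNIV (\<lambda>_. borel)) (rising k)"
  unfolding rising_def[abs_def] by measurable

lemma valley_measurable [measurable]:
  "Measurable.pred (PiM UNIV (\<lambda>_. borel)) (valley j N)"
  unfolding valley_def[abs_def] by measurable

text \<open>By exchangeability each of the \<open>k!\<close> permutations is equally likely to be the sorting one,
  and almost surely exactly one is.\<close>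

lemma prob_rising: "prob {\<omega> \<in> space M. rising k (\<lambda>n. X n \<omega>)} = 1 / fact k"
proof -
  let ?perms = "{p. p permutes {..<k}}"
  let ?A = "\<lambda>p. {\<omega> \<in> space M. inj (\<lambda>n. X n \<omega>) \<and> rising k (\<lambda>n. X (p n) \<omega>)}"
  have inj_event [measurable]: "Measurable.pred M (\<lambda>\<omega>. inj (\<lambda>n. X n \<omega>))"
    unfolding inj_def by measurable
  have events: "?A p \<in> events" for p
    unfolding rising_def by measurable
  have eq: "prob (?A p) = prob {\<omega> \<in> space M. rising k (\<lambda>n. X n \<omega>)}" if "p \<in> ?perms" for p
  proof -
    have "prob (?A p) = prob {\<omega> \<in> space M. rising k (\<lambda>n. X (p n) \<omega>)}"
      by (rule finite_measure_eq_AE)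
         (use AE_inj in \<open>auto simp: rising_def elim: eventually_mono\<close>)
    also have "\<dots> = prob {\<omega> \<in> space M. rising k (\<lambda>n. X n \<omega>)}"
      using that by (intro prob_reindex) (auto intro: permutes_inj)
    finally show ?thesis .
  qed
  have "1 = prob (\<Union>p\<in>?perms. ?A p)"
  proof -
    have "prob (\<Union>p\<in>?perms. ?A p) = prob (space M)"
      using events AE_inj
      by (intro finite_measure_eq_AE sets.finite_UN)
         (auto simp: finite_permutations intro: ex_sorting_permutation elim!: eventually_mono)
    then show ?thesis by (simp add: prob_space)
  qed
  also have "\<dots> = (\<Sum>p\<in>?perms. prob (?A p))"
    using events
    by (intro finite_measure_finite_Union)
       (auto simp: finite_permutations disjoint_family_on_def dest: sorting_permutation_unique)
  also have "\<dots> = fact k * prob {\<omega> \<in> space M. rising k (\<lambda>n. X n \<omega>)}"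
    by (simp add: eq card_permutations)
  finally have "prob {\<omega> \<in> space M. rising k (\<lambda>n. X n \<omega>)} * fact k = 1"
    by (simp only: mult.commute)
  then show ?thesis by (intro eq_divide_imp) simp_all
qed

text \<open>The two runs involve disjoint sets of variables and are independent. Each of them, the first one
  read backwards, is an increasing block.\<close>

lemma prob_two_runs:
  assumes "j \<le> N"
  shows "prob {\<omega> \<in> space M. two_runs j N (\<lambda>n. X n \<omega>)} = 1 / (fact j * fact (N - j))"
proof -
  let ?I = "{..<j}" and ?J = "{j..<N}"
  define A where "A = {x \<in> space (PiM ?I (\<lambda>_. borel :: real measure)). \<forall>i. Suc i < j \<longrightarrow> x (Suc i) < x i}"
  define B where "B = {x \<in> space (PiM ?J (\<lambda>_. borel :: real measure)). \<forall>i. j \<le> i \<and> Suc i < N \<longrightarrow> x i < x (Suc i)}"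
  let ?f = "\<lambda>\<omega>. restrict (\<lambda>i. X i \<omega>) ?I" and ?g = "\<lambda>\<omega>. restrict (\<lambda>i. X i \<omega>) ?J"
  have less: "{x \<in> space (PiM K (\<lambda>_. borel :: real measure)). Q \<longrightarrow> x a < x b} \<in> sets (PiM K (\<lambda>_. borel))"
    if "Q \<Longrightarrow> a \<in> K" "Q \<Longrightarrow> b \<in> K" for Q and a b :: nat and K
  proof (cases Q)
    case True
    have "(\<lambda>x. x c) \<in> borel_measurable (PiM K (\<lambda>_. borel :: real measure))" if "c \<in> K" for c
      using that by (rule measurable_component_singleton)
    then have "{x \<in> space (PiM K (\<lambda>_. borel :: real measure)). x a < x b} \<in> sets (PiM K (\<lambda>_. borel))"
      using that True by (intro borel_measurable_less) blast+
    with True show ?thesis by (simp only: simp_thms)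
  next
    case False
    then show ?thesis by (simp only: simp_thms Collect_mem_eq sets.top)
  qed
  have A: "A \<in> sets (PiM ?I (\<lambda>_. borel))"
    unfolding A_def by (rule sets.sets_Collect_countable_All, rule less) simp_all
  have B: "B \<in> sets (PiM ?J (\<lambda>_. borel))"
    unfolding B_def by (rule sets.sets_Collect_countable_All, rule less) simp_all
  have "indep_var (PiM ?I (\<lambda>_. borel)) ?f (PiM ?J (\<lambda>_. borel)) ?g"
    using indep by (rule indep_var_restrict) auto
  note split = indep_varD[OF this A B]
  have f: "?f \<omega> \<in> A \<longleftrightarrow> (\<forall>i. Suc i < j \<longrightarrow> X (Suc i) \<omega> < X i \<omega>)" for \<omega>
    by (auto simp: A_def space_PiM)
  have g: "?g \<omega> \<in> B \<longleftrightarrow> (\<forall>i. j \<le> i \<and> Suc i < N \<longrightarrow> X i \<omega> < X (Suc i) \<omega>)" for \<omega>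
    by (auto simp: B_def space_PiM)
  have "(\<lambda>\<omega>. (?f \<omega>, ?g \<omega>)) -` (A \<times> B) \<inter> space M = {\<omega> \<in> space M. two_runs j N (\<lambda>n. X n \<omega>)}"
    using f g by (auto simp: two_runs_def)
  moreover have "?f -` A \<inter> space M =
      {\<omega> \<in> space M. rising j (\<lambda>n. X (if n < j then j - Suc n else n) \<omega>)}"
    using f falling_iff_rising_reversed[of j "\<lambda>n. X n \<omega>" for \<omega>] by blast
  moreover have "?g -` B \<inter> space M = {\<omega> \<in> space M. rising (N - j) (\<lambda>n. X (n + j) \<omega>)}"
    using g rising_from_iff[of j N "\<lambda>n. X n \<omega>" for \<omega>] by blast
  moreover have "inj (\<lambda>n. if n < j then j - Suc n else n)"
    by (rule injI) (auto split: if_splits)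
  then have "prob {\<omega> \<in> space M. rising j (\<lambda>n. X (if n < j then j - Suc n else n) \<omega>)} = 1 / fact j"
    by (subst prob_reindex) (auto simp: prob_rising)
  moreover have "prob {\<omega> \<in> space M. rising (N - j) (\<lambda>n. X (n + j) \<omega>)} = 1 / fact (N - j)"
    by (subst prob_reindex) (auto simp: prob_rising)
  ultimately show ?thesis using split by simp
qed

text \<open>Splitting two runs at the step between them expresses the probability of two runs as a sum of the
  probabilities of two adjacent valley positions. Induction on the position then is Pascal's rule
  after multiplication by \<open>N!\<close>.\<close>

lemma prob_valley:
  assumes "j < N"
  shows "prob {\<omega> \<in> space M. valley j N (\<lambda>n. X n \<omega>)} = ((N - 1) choose j) / fact N"
  using assms
proof (induction j)
  case 0
  have "valley 0 N = rising N" by (auto simp: valley_def rising_def fun_eq_iff)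
  then show ?case by (simp add: prob_rising)
next
  case (Suc j)
  let ?V = "\<lambda>j. {\<omega> \<in> space M. valley j N (\<lambda>n. X n \<omega>)}"
  have [measurable]: "?V i \<in> events" for i unfolding valley_def by measurable
  have "prob {\<omega> \<in> space M. two_runs (Suc j) N (\<lambda>n. X n \<omega>)} = prob (?V (Suc j) \<union> ?V j)"
  proof (rule finite_measure_eq_AE)
    show "AE \<omega> in M. \<omega> \<in> {\<omega> \<in> space M. two_runs (Suc j) N (\<lambda>n. X n \<omega>)} \<longleftrightarrow> \<omega> \<in> ?V (Suc j) \<union> ?V j"
      using AE_neq[of j "Suc j"] two_runs_Suc_iff Suc.prems by (auto elim!: eventually_mono)
  qed (simp_all add: two_runs_def)
  also have "\<dots> = prob (?V (Suc j)) + prob (?V j)"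
    using Suc.prems by (intro finite_measure_Union) (auto dest: valley_unique)
  finally have "prob (?V (Suc j)) = 1 / (fact (Suc j) * fact (N - Suc j)) - ((N - 1) choose j) / fact N"
    using Suc prob_two_runs[of "Suc j" N] by simp
  also have "1 / (fact (Suc j) * fact (N - Suc j)) = (N choose Suc j) / fact N"
    using Suc.prems by (simp add: binomial_fact)
  also have "N choose Suc j = ((N - 1) choose Suc j) + ((N - 1) choose j)"
    using Suc.prems by (cases N) auto
  finally show ?case by (simp only: of_nat_add add_divide_distrib add_diff_cancel_right')
qed

text \<open>Row \<open>n + 2\<close> of Pascal's triangle without its last two entries \<open>n + 2\<close> and \<open>1\<close>; these
  belong to the orders with one final ascent and with none.\<close>

lemma prob_first_peak_132:
  "prob {\<omega> \<in> space M. first_peak_132 n (\<lambda>n. X n \<omega>)} = (2 ^ (n + 2) - real (n + 3)) / fact (n + 3)"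
proof -
  let ?swap = "Transposition.transpose (Suc n) (Suc (Suc n))"
  let ?V = "\<lambda>j. {\<omega> \<in> space M. valley j (n + 3) (\<lambda>i. X (?swap i) \<omega>)}"
  have events: "?V j \<in> events" for j unfolding valley_def by measurable
  have "prob {\<omega> \<in> space M. first_peak_132 n (\<lambda>n. X n \<omega>)} = prob (\<Union>j\<in>{..n}. ?V j)"
  proof (rule finite_measure_eq_AE)
    show "AE \<omega> in M. \<omega> \<in> {\<omega> \<in> space M. first_peak_132 n (\<lambda>n. X n \<omega>)} \<longleftrightarrow> \<omega> \<in> (\<Union>j\<in>{..n}. ?V j)"
      using AE_inj by eventually_elim (auto simp: first_peak_132_iff_valley)
  qed (use events in \<open>auto simp: first_peak_132_def\<close>)
  also have "\<dots> = (\<Sum>j\<le>n. prob (?V j))"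
    using events
    by (intro finite_measure_finite_Union) (auto simp: disjoint_family_on_def dest: valley_unique)
  also have "\<dots> = (\<Sum>j\<le>n. ((n + 2) choose j) / fact (n + 3))"
  proof (rule sum.cong[OF refl])
    fix j assume "j \<in> {..n}"
    have "prob (?V j) = prob {\<omega> \<in> space M. valley j (n + 3) (\<lambda>i. X i \<omega>)}"
      by (intro prob_reindex) auto
    with \<open>j \<in> {..n}\<close> show "prob (?V j) = ((n + 2) choose j) / fact (n + 3)"
      by (simp add: prob_valley)
  qed
  also have "\<dots> = (\<Sum>j\<le>n. real ((n + 2) choose j)) / fact (n + 3)"
    by (simp add: sum_divide_distrib)
  also have "(\<Sum>j\<le>n. real ((n + 2) choose j)) = 2 ^ (n + 2) - real (n + 3)"
  proof -
    have "(\<Sum>j\<le>Suc (Suc n). real ((n + 2) choose j)) = 2 ^ (n + 2)"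
      using choose_row_sum[of "n + 2"]
      by (metis Suc_1 add_2_eq_Suc' of_nat_numeral of_nat_power of_nat_sum)
    then show ?thesis by simp
  qed
  finally show ?thesis .
qed

lemma prob_132_before_231: "prob_before M X [1, 3, 2] [2, 3, 1] = ((exp 1)\<^sup>2 - 2 * exp 1 - 1) / 2"
proof -
  let ?A = "\<lambda>n. {\<omega> \<in> space M. first_peak_132 n (\<lambda>n. X n \<omega>)}"
  have events: "?A n \<in> events" for n unfolding first_peak_132_def by measurable
  have union: "prob_before M X [1, 3, 2] [2, 3, 1] = prob (\<Union>n. ?A n)"
    unfolding prob_before_def
  proof (rule finite_measure_eq_AE)
    show "AE \<omega> in M. \<omega> \<in> {\<omega> \<in> space M. first_occurrence [1, 3, 2] (\<lambda>n. X n \<omega>)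
        < first_occurrence [2, 3, 1] (\<lambda>n. X n \<omega>)} \<longleftrightarrow> \<omega> \<in> (\<Union>n. ?A n)"
      using AE_inj by eventually_elim (simp only: first_132_before_231_iff mem_Collect_eq UN_iff, blast)
    show "{\<omega> \<in> space M. first_occurrence [1, 3, 2] (\<lambda>n. X n \<omega>)
        < first_occurrence [2, 3, 1] (\<lambda>n. X n \<omega>)} \<in> events"
      unfolding first_occurrence_less_iff occurs_at_132_iff occurs_at_231_iff by measurable
  qed (use events in auto)
  have total: "(\<lambda>n. prob (?A n)) sums prob (\<Union>n. ?A n)"
    using events
    by (intro finite_measure_UNION) (auto simp: disjoint_family_on_def dest: first_peak_132_unique)
  have series: "(\<lambda>n. prob (?A n)) sums (((exp 1)\<^sup>2 - 2 * exp 1 - 1) / 2)"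
  proof -
    \<comment> \<open>With \<open>m = n + 3\<close> the summand is half of \<open>2 ^ m / m!\<close> minus \<open>1 / (m - 1)!\<close>, so
      two tails of the exponential series appear, starting at the indices \<open>3\<close> and \<open>2\<close>.\<close>
    have exp: "(\<lambda>n. z ^ n / fact n) sums exp z" for z :: real
      using exp_converges[of z] by (simp add: divide_inverse mult.commute)
    have "(\<lambda>n. 2 ^ n / fact n / 2) sums (exp 2 / 2 :: real)"
      using exp[of 2] by (rule sums_divide)
    from sums_split_initial_segment[OF this, of 3]
    have two: "(\<lambda>n. 2 ^ (n + 2) / fact (n + 3)) sums (exp 2 / 2 - 5 / 2 :: real)"
      by (simp add: numeral_3_eq_3 numeral_2_eq_2 mult.commute mult.left_commute)
    from sums_split_initial_segment[OF exp[of 1], of 2]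
    have one: "(\<lambda>n. 1 / fact (n + 2)) sums (exp 1 - 2 :: real)"
      by (simp add: numeral_2_eq_2)
    have "(\<lambda>n. 2 ^ (n + 2) / fact (n + 3) - 1 / fact (n + 2)) sums
        (exp 2 / 2 - 5 / 2 - (exp 1 - 2) :: real)"
      by (rule sums_diff[OF two one])
    moreover have "2 ^ (n + 2) / fact (n + 3) - 1 / fact (n + 2) = prob (?A n)" for n
    proof -
      have "fact (n + 3) = real (n + 3) * fact (n + 2)" by (simp add: numeral_3_eq_3)
      then have "1 / fact (n + 2) = real (n + 3) / fact (n + 3)" by simp
      then show ?thesis by (simp add: prob_first_peak_132 diff_divide_distrib)
    qed
    moreover have "exp 2 / 2 - 5 / 2 - (exp 1 - 2) = ((exp 1)\<^sup>2 - 2 * exp 1 - 1 :: real) / 2"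
      using exp_double[of 1] by (simp add: field_simps)
    ultimately show ?thesis by simp
  qed
  show ?thesis using union sums_unique2[OF total series] by (rule trans)
qed

end

section \<open>The numerical value\<close>

text \<open>The numerical claim leaves a margin of about \<open>0.00025\<close>, and the closed form has derivative
  \<open>e - 1\<close> in \<open>e\<close>, so four decimals suffice. Nine Taylor terms give them.\<close>

lemma exp_1_bounds: "2.7182 < exp (1 :: real)" "exp (1 :: real) < 2.7183"
proof -
  obtain t :: real where t: "\<bar>t\<bar> \<le> 1" and e: "exp 1 = (\<Sum>m<9. 1 / fact m) + exp t / fact 9"
    using Maclaurin_exp_le[of 1 9] by auto
  have "exp t \<le> 3" using t exp_le exp_le_cancel_iff[of t 1] by linarith
  moreover have "0 < exp t" by simp
  moreover have "exp 1 = 109601 / 40320 + exp t / 362880"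
    using e by (simp add: eval_nat_numeral)
  moreover have "(2.7182 :: real) < 109601 / 40320" "109601 / 40320 + 3 / 362880 < (2.7183 :: real)"
    by simp_all
  ultimately show "2.7182 < exp (1 :: real)" "exp (1 :: real) < 2.7183"
    by - linarith+
qed

theorem theorem4p1:
  fixes M :: "'a measure" and X :: "nat \<Rightarrow> 'a \<Rightarrow> real"
  assumes "prob_space M" and "iid_continuous M X"
  shows "prob_before M X [1, 3, 2] [2, 3, 1] = ((exp 1)\<^sup>2 - 2 * exp 1 - 1) / 2
    \<and> \<bar>prob_before M X [1, 3, 2] [2, 3, 1] - 0.476\<bar> < 0.0005"
proof -
  interpret prob_space M by fact
  interpret iid_continuous_sequence M X by unfold_locales fact
  \<comment> \<open>Completing the square makes the value monotone in the Euler number above \<open>1\<close>.\<close>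
  have closed_form: "prob_before M X [1, 3, 2] [2, 3, 1] = ((exp 1 - 1)\<^sup>2 - 2) / 2"
    unfolding prob_132_before_231 by (simp add: power2_diff)
  have "1.7182\<^sup>2 \<le> (exp 1 - 1 :: real)\<^sup>2" "(exp 1 - 1 :: real)\<^sup>2 \<le> 1.7183\<^sup>2"
    using exp_1_bounds by (intro power_mono; simp)+
  then have "\<bar>((exp 1 - 1 :: real)\<^sup>2 - 2) / 2 - 0.476\<bar> < 0.0005"
    by (simp add: power2_eq_square abs_less_iff)
  then have "\<bar>prob_before M X [1, 3, 2] [2, 3, 1] - 0.476\<bar> < 0.0005"
    by (simp only: closed_form)
  with prob_132_before_231 show ?thesis by (rule conjI)
qed

end
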